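(* Let $(H,\langle\cdot,\cdot\rangle)$ be an inner product space over $\mathbb{K}$ ($\mathbb{K}=\mathbb{R}$ or $\mathbb{C}$), let $\{e_i\}_{i\in I}$ be a family of orthonormal vectors in $H$, let $F$ be a finite subset of $I$, and let $\phi_i,\Phi_i\in\mathbb{K}$ $(i\in F)$ be such that $\sum_{i\in F}\operatorname{Re}(\Phi_i\overline{\phi_i})>0$. Let $x\in H$. Then the following two conditions are equivalent: (i) $\operatorname{Re}\left\langle \sum_{i\in F}\Phi_i e_i-x,\;x-\sum_{i\in F}\phi_i e_i\right\rangle\ge 0$; (ii) $\left\|x-\sum_{i\in F}\frac{\phi_i+\Phi_i}{2}e_i\right\|\le \frac12\left(\sum_{i\in F}|\Phi_i-\phi_i|^2\right)^{1/2}$; and if either of them holds, then $$\|x\|^2\le \frac14\cdot\frac{\sum_{i\in F}(|\Phi_i|+|\phi_i|)^2}{\sum_{i\in F}\operatorname{Re}(\Phi_i\overline{\phi_i})}\sum_{i\in F}|\langle x,e_i\rangle|^2 .$$ The constant $\frac14$ is best possible in the sense that it cannot be replaced by a smaller constant: there is no $c<\frac14$ such that the inequality with $c$ in place of $\frac14$ holds for all $H$, $\{e_i\}_{i\in I}$, $F$, $\phi_i,\Phi_i$ and $x$ satisfying the hypotheses.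
   Context: The inner product is linear in the first argument and conjugate-linear in the second, and $\|x\|=\langle x,x\rangle^{1/2}$. A family $\{e_i\}_{i\in I}$ is orthonormal if $\langle e_i,e_j\rangle=0$ for $i\neq j$ and $\|e_i\|=1$ for all $i\in I$. *)

theory Defs
  imports "HOL-Analysis.Analysis" "HOL-Library.Function_Algebras"
begin

text \<open>
  Inner product spaces over a scalar field that is either the reals or the complex numbers.
  Both cases are treated at once by taking the scalars to be a set \<open>K\<close> of complex numbers, so
  that conjugation, real part and modulus are \<^const>\<open>cnj\<close>, \<^const>\<open>Re\<close> and \<^const>\<open>cmod\<close>.
  The space is a carrier \<open>H\<close> inside an ambient abelian group, which makes it possible to quantify
  over spaces within a formula; the pointwise group \<open>nat \<Rightarrow> complex\<close> contains a copy of every space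
  of Hamel dimension at most the continuum. The values of \<open>smul\<close> and \<open>ip\<close> outside \<open>K\<close> and \<open>H\<close> are irrelevant.
  Conjugate-linearity in the second argument follows from \<open>ip_add_left\<close>, \<open>ip_smul_left\<close> and
  \<open>ip_commute\<close>.
\<close>

locale inner_product_space =
  fixes K :: "complex set"
    and H :: "'v::ab_group_add set"
    and smul :: "complex \<Rightarrow> 'v \<Rightarrow> 'v"
    and ip :: "'v \<Rightarrow> 'v \<Rightarrow> complex"
  assumes scalars: "K = \<real> \<or> K = UNIV"
    and zero_closed: "0 \<in> H"
    and add_closed: "x \<in> H \<Longrightarrow> y \<in> H \<Longrightarrow> x + y \<in> H"
    and smul_closed: "a \<in> K \<Longrightarrow> x \<in> H \<Longrightarrow> smul a x \<in> H"
    and smul_right_distrib: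
      "a \<in> K \<Longrightarrow> x \<in> H \<Longrightarrow> y \<in> H \<Longrightarrow> smul a (x + y) = smul a x + smul a y"
    and smul_left_distrib:
      "a \<in> K \<Longrightarrow> b \<in> K \<Longrightarrow> x \<in> H \<Longrightarrow> smul (a + b) x = smul a x + smul b x"
    and smul_smul: "a \<in> K \<Longrightarrow> b \<in> K \<Longrightarrow> x \<in> H \<Longrightarrow> smul a (smul b x) = smul (a * b) x"
    and smul_one: "x \<in> H \<Longrightarrow> smul 1 x = x"
    and ip_closed: "x \<in> H \<Longrightarrow> y \<in> H \<Longrightarrow> ip x y \<in> K"
    and ip_add_left: "x \<in> H \<Longrightarrow> y \<in> H \<Longrightarrow> z \<in> H \<Longrightarrow> ip (x + y) z = ip x z + ip y z"
    and ip_smul_left: "a \<in> K \<Longrightarrow> x \<in> H \<Longrightarrow> y \<in> H \<Longrightarrow> ip (smul a x) y = a * ip x y"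
    and ip_commute: "x \<in> H \<Longrightarrow> y \<in> H \<Longrightarrow> ip y x = cnj (ip x y)"
    and ip_pos: "x \<in> H \<Longrightarrow> x \<noteq> 0 \<Longrightarrow> 0 < Re (ip x x)"

text \<open>\<open>ip x x\<close> is real by \<open>ip_commute\<close>, so taking its real part loses nothing.\<close>

definition ip_norm :: "('v \<Rightarrow> 'v \<Rightarrow> complex) \<Rightarrow> 'v \<Rightarrow> real" where
  "ip_norm ip x = sqrt (Re (ip x x))"

definition orthonormal_family ::
    "('v \<Rightarrow> 'v \<Rightarrow> complex) \<Rightarrow> 'i set \<Rightarrow> ('i \<Rightarrow> 'v) \<Rightarrow> bool" where
  "orthonormal_family ip I e \<longleftrightarrow>
     (\<forall>i\<in>I. \<forall>j\<in>I. i \<noteq> j \<longrightarrow> ip (e i) (e j) = 0) \<and> (\<forall>i\<in>I. ip_norm ip (e i) = 1)"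

definition orthonormal_setting ::
    "complex set \<Rightarrow> 'v::ab_group_add set \<Rightarrow> (complex \<Rightarrow> 'v \<Rightarrow> 'v) \<Rightarrow> ('v \<Rightarrow> 'v \<Rightarrow> complex) \<Rightarrow>
     'i set \<Rightarrow> ('i \<Rightarrow> 'v) \<Rightarrow> 'i set \<Rightarrow> ('i \<Rightarrow> complex) \<Rightarrow> ('i \<Rightarrow> complex) \<Rightarrow> 'v \<Rightarrow> bool" where
  "orthonormal_setting K H smul ip I e F \<phi> \<Phi> x \<longleftrightarrow>
     inner_product_space K H smul ip \<and>
     e ` I \<subseteq> H \<and> orthonormal_family ip I e \<and>
     finite F \<and> F \<subseteq> I \<and>
     \<phi> ` F \<subseteq> K \<and> \<Phi> ` F \<subseteq> K \<and>
     (\<Sum>i\<in>F. Re (\<Phi> i * cnj (\<phi> i))) > 0 \<and>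
     x \<in> H"

text \<open>Every space of class \<^class>\<open>real_inner\<close> is an instance with real scalars.\<close>

lemma real_inner_inner_product_space:
  "inner_product_space \<real> (UNIV :: 'v::real_inner set)
     (\<lambda>a. scaleR (Re a)) (\<lambda>x y. complex_of_real (inner x y))"
  by unfold_locales
    (auto simp: scaleR_right_distrib scaleR_left_distrib inner_left_distrib inner_right_distrib inner_commute
      complex_is_Real_iff complex_eq_iff)

lemma complex_inner_product_space:
  "inner_product_space UNIV (UNIV :: complex set) (*) (\<lambda>x y. x * cnj y)"
  by unfold_locales
    (auto simp: algebra_simps complex_eq_iff intro: add_pos_nonneg add_nonneg_pos
      simp flip: power2_eq_square simp add: sum_power2_gt_zero_iff)

end

theory Submission
  imports Defs
begin

text \<open>
  Write \<open>S\<close>, \<open>s\<close> and \<open>m\<close> for the combinations of the \<open>e i\<close> with coefficients \<open>\<Phi> i\<close>, \<open>\<phi> i\<close> and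
  \<open>(\<phi> i + \<Phi> i) / 2\<close>. Since \<open>m\<close> is the midpoint of \<open>s\<close> and \<open>S\<close>, the vector \<open>d = S - m = m - s\<close>
  satisfies \<open>S - x = d - (x - m)\<close> and \<open>x - s = d + (x - m)\<close>, whence
  \<open>Re \<langle>S - x, x - s\<rangle> = \<parallel>d\<parallel>\<^sup>2 - \<parallel>x - m\<parallel>\<^sup>2\<close>. Geometrically, \<open>x\<close> sees the segment from \<open>s\<close> to \<open>S\<close> under
  an angle of at least a right angle exactly when it lies in the ball having that segment as
  diameter. By orthonormality the radius is \<open>\<parallel>d\<parallel> = 1/2 (\<Sum>i\<in>F. \<bar>\<Phi> i - \<phi> i\<bar>\<^sup>2)\<^sup>1\<^sup>/\<^sup>2\<close>, which gives the
  equivalence of the two conditions.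

  For the bound, put \<open>P = Re \<langle>S, s\<rangle> = (\<Sum>i\<in>F. Re (\<Phi> i * cnj (\<phi> i))) > 0\<close>. Expanding condition (i) gives
  \<open>\<parallel>x\<parallel>\<^sup>2 + P \<le> Re \<langle>x, s\<rangle> + Re \<langle>S, x\<rangle> \<le> (\<Sum>i\<in>F. (\<bar>\<Phi> i\<bar> + \<bar>\<phi> i\<bar>) \<bar>\<langle>x, e i\<rangle>\<bar>)\<close>. The arithmetic-geometric mean
  inequality \<open>4 P \<parallel>x\<parallel>\<^sup>2 \<le> (\<parallel>x\<parallel>\<^sup>2 + P)\<^sup>2\<close> on the left and the Cauchy-Schwarz inequality for finite sums
  on the right then give the claim (lemma \<open>reverse_bessel\<close>).

  All these inequalities are equalities in the scalar line when the family consists of one unit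
  vector \<open>e\<close> and \<open>\<phi> = \<Phi> = 1\<close>, \<open>x = e\<close>: the bound with constant \<open>c\<close> then reads \<open>1 \<le> 4 c\<close>. A copy of
  the scalar line inside \<open>nat \<Rightarrow> complex\<close> therefore shows that \<open>1/4\<close> is best possible.
\<close>

section \<open>Inner products of finite linear combinations\<close>

context inner_product_space
begin

lemma scalar_closed:
  assumes "a \<in> K" and "b \<in> K"
  shows "a + b \<in> K" and "a - b \<in> K" and "a / 2 \<in> K"
  using scalars assms by auto

lemma minus_one_scalar: "- 1 \<in> K"
  using scalars by auto

lemma smul_zero_left:
  assumes "x \<in> H"
  shows "smul 0 x = 0"
proof -
  have "0 \<in> K"
    using scalars by auto
  then have "smul (0 + 0) x = smul 0 x + smul 0 x"
    using assms by (intro smul_left_distrib)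
  then show ?thesis
    by simp
qed

lemma smul_minus_one:
  assumes "x \<in> H"
  shows "smul (- 1) x = - x"
proof -
  have "1 \<in> K"
    using scalars by auto
  then have "smul (- 1 + 1) x = smul (- 1) x + smul 1 x"
    using minus_one_scalar assms by (intro smul_left_distrib)
  then show ?thesis
    using assms by (simp add: smul_zero_left smul_one eq_neg_iff_add_eq_0)
qed

lemma diff_closed: "x - y \<in> H" if "x \<in> H" and "y \<in> H"
  using add_closed[OF that(1) smul_closed[OF minus_one_scalar that(2)]] that
  by (simp add: smul_minus_one)

lemma smul_diff_left:
  assumes "a \<in> K" and "b \<in> K" and "x \<in> H"
  shows "smul (a - b) x = smul a x - smul b x"
  using smul_left_distrib[of "a - b" b x] scalar_closed assms by (simp add: eq_diff_eq)

lemma ip_diff_left: "ip (x - y) z = ip x z - ip y z" if "x \<in> H" "y \<in> H" "z \<in> H"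
  using ip_add_left[OF diff_closed[OF that(1,2)] that(2,3)] by simp

lemma ip_add_right: "ip z (x + y) = ip z x + ip z y" if "x \<in> H" "y \<in> H" "z \<in> H"
  using that ip_commute[of "x + y" z] ip_commute[of x z] ip_commute[of y z]
  by (simp add: add_closed ip_add_left)

lemma ip_diff_right: "ip z (x - y) = ip z x - ip z y" if "x \<in> H" "y \<in> H" "z \<in> H"
  using ip_add_right[OF diff_closed[OF that(1,2)] that(2,3)] by simp

lemma ip_zero_left:
  assumes "y \<in> H"
  shows "ip 0 y = 0"
  using ip_add_left[OF zero_closed zero_closed assms] by simp

lemma Re_ip_self_nonneg: "0 \<le> Re (ip x x)" if "x \<in> H"
  using that ip_pos[of x] ip_zero_left[OF zero_closed] by (cases "x = 0") auto

lemma ip_norm_power2: "(ip_norm ip x)\<^sup>2 = Re (ip x x)" if "x \<in> H"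
  using Re_ip_self_nonneg[OF that] by (simp add: ip_norm_def)

text \<open>The cross terms \<open>\<langle>d, y\<rangle>\<close> and \<open>\<langle>y, d\<rangle>\<close> are conjugate, so their difference has real part zero.\<close>

lemma Re_ip_diff_add:
  assumes "d \<in> H" and "y \<in> H"
  shows "Re (ip (d - y) (d + y)) = Re (ip d d) - Re (ip y y)"
  using assms ip_commute[of d y]
  by (simp add: ip_diff_left ip_add_right add_closed)

lemma lincomb_closed: "(\<Sum>i\<in>F. smul (a i) (e i)) \<in> H" if "a ` F \<subseteq> K" and "e ` F \<subseteq> H"
  using that
  by (induction F rule: infinite_finite_induct) (auto simp: zero_closed add_closed smul_closed)

lemma lincomb_diff:
  assumes "a ` F \<subseteq> K" and "b ` F \<subseteq> K" and "e ` F \<subseteq> H"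
  shows "(\<Sum>i\<in>F. smul (a i) (e i)) - (\<Sum>i\<in>F. smul (b i) (e i)) = (\<Sum>i\<in>F. smul (a i - b i) (e i))"
  unfolding sum_subtractf[symmetric]
  using assms by (intro sum.cong) (auto simp: smul_diff_left image_subset_iff)

lemma ip_lincomb_left:
  assumes "a ` F \<subseteq> K" and "e ` F \<subseteq> H" and "y \<in> H"
  shows "ip (\<Sum>i\<in>F. smul (a i) (e i)) y = (\<Sum>i\<in>F. a i * ip (e i) y)"
  using assms
proof (induction F rule: infinite_finite_induct)
  case (insert i F)
  then have "(\<Sum>i\<in>F. smul (a i) (e i)) \<in> H"
    by (intro lincomb_closed) auto
  with insert show ?case
    by (simp add: ip_add_left smul_closed ip_smul_left)
qed (simp_all add: ip_zero_left)

lemma ip_lincomb_right: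
  assumes "b ` F \<subseteq> K" and "e ` F \<subseteq> H" and "y \<in> H"
  shows "ip y (\<Sum>i\<in>F. smul (b i) (e i)) = (\<Sum>i\<in>F. cnj (b i) * ip y (e i))"
proof -
  have "ip y (\<Sum>i\<in>F. smul (b i) (e i)) = cnj (\<Sum>i\<in>F. b i * ip (e i) y)"
    using ip_commute[OF lincomb_closed[OF assms(1,2)] assms(3)] assms by (simp add: ip_lincomb_left)
  also have "\<dots> = (\<Sum>i\<in>F. cnj (b i) * ip y (e i))"
    unfolding cnj_sum using assms ip_commute[OF _ assms(3)]
    by (intro sum.cong) (auto simp: image_subset_iff)
  finally show ?thesis .
qed

lemma ip_orthonormal:
  assumes "orthonormal_family ip I e" and "e ` I \<subseteq> H" and "i \<in> I" and "j \<in> I"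
  shows "ip (e i) (e j) = (if i = j then 1 else 0)"
proof (cases "i = j")
  case True
  have mem: "e i \<in> H"
    using assms by auto
  have "Re (ip (e i) (e i)) = 1"
    using assms unfolding orthonormal_family_def ip_norm_def by simp
  moreover have "Im (ip (e i) (e i)) = 0"
    using ip_commute[OF mem mem] by (simp add: complex_eq_iff)
  ultimately show ?thesis
    using True by (simp add: complex_eq_iff)
next
  case False
  then show ?thesis
    using assms unfolding orthonormal_family_def by simp
qed

lemma ip_lincomb_orthonormal:
  assumes on: "orthonormal_family ip I e" and eI: "e ` I \<subseteq> H"
    and F: "finite F" "F \<subseteq> I" and K: "a ` F \<subseteq> K" "b ` F \<subseteq> K"
  shows "ip (\<Sum>i\<in>F. smul (a i) (e i)) (\<Sum>i\<in>F. smul (b i) (e i)) = (\<Sum>i\<in>F. a i * cnj (b i))"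
proof -
  have eF: "e ` F \<subseteq> H"
    using eI F by auto
  have "ip (\<Sum>i\<in>F. smul (a i) (e i)) (\<Sum>i\<in>F. smul (b i) (e i))
      = (\<Sum>i\<in>F. a i * ip (e i) (\<Sum>j\<in>F. smul (b j) (e j)))"
    using K eF by (intro ip_lincomb_left lincomb_closed)
  also have "\<dots> = (\<Sum>i\<in>F. a i * cnj (b i))"
  proof (rule sum.cong)
    fix i assume i: "i \<in> F"
    have "ip (e i) (\<Sum>j\<in>F. smul (b j) (e j)) = (\<Sum>j\<in>F. cnj (b j) * ip (e i) (e j))"
      using K eF i by (intro ip_lincomb_right) auto
    also have "\<dots> = (\<Sum>j\<in>F. if i = j then cnj (b j) else 0)"
      using F i by (intro sum.cong) (auto simp: ip_orthonormal[OF on eI] subset_iff)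
    also have "\<dots> = cnj (b i)"
      using F i by simp
    finally show "a i * ip (e i) (\<Sum>j\<in>F. smul (b j) (e j)) = a i * cnj (b i)"
      by simp
  qed simp
  finally show ?thesis .
qed

section \<open>The two conditions and the reverse Bessel inequality\<close>

text \<open>
  Both conditions compare the same two numbers: condition (i) is \<open>0 \<le> \<parallel>d\<parallel>\<^sup>2 - \<parallel>x - m\<parallel>\<^sup>2\<close> and
  condition (ii) is \<open>\<parallel>x - m\<parallel> \<le> \<parallel>d\<parallel>\<close>, for the midpoint \<open>m\<close> and the half-difference \<open>d\<close>.
\<close>

lemma angle_condition_iff_ball_condition:
  assumes on: "orthonormal_family ip I e" and eI: "e ` I \<subseteq> H"
    and F: "finite F" "F \<subseteq> I" and K: "\<phi> ` F \<subseteq> K" "\<Phi> ` F \<subseteq> K" and x: "x \<in> H"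
  shows "0 \<le> Re (ip ((\<Sum>i\<in>F. smul (\<Phi> i) (e i)) - x) (x - (\<Sum>i\<in>F. smul (\<phi> i) (e i))))
    \<longleftrightarrow> ip_norm ip (x - (\<Sum>i\<in>F. smul ((\<phi> i + \<Phi> i) / 2) (e i)))
          \<le> 1 / 2 * sqrt (\<Sum>i\<in>F. (cmod (\<Phi> i - \<phi> i))\<^sup>2)"
proof -
  define S where "S = (\<Sum>i\<in>F. smul (\<Phi> i) (e i))"
  define s where "s = (\<Sum>i\<in>F. smul (\<phi> i) (e i))"
  define m where "m = (\<Sum>i\<in>F. smul ((\<phi> i + \<Phi> i) / 2) (e i))"
  define d where "d = (\<Sum>i\<in>F. smul ((\<Phi> i - \<phi> i) / 2) (e i))"
  let ?D = "\<Sum>i\<in>F. (cmod (\<Phi> i - \<phi> i))\<^sup>2"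
  have eF: "e ` F \<subseteq> H"
    using eI F by auto
  have mK: "(\<lambda>i. (\<phi> i + \<Phi> i) / 2) ` F \<subseteq> K" and dK: "(\<lambda>i. (\<Phi> i - \<phi> i) / 2) ` F \<subseteq> K"
    using K scalar_closed by (auto simp: image_subset_iff)
  have mH: "m \<in> H" and dH: "d \<in> H"
    unfolding m_def d_def using mK dK eF by (auto intro: lincomb_closed)
  have yH: "x - m \<in> H"
    using x mH by (rule diff_closed)
  have "S - m = (\<Sum>i\<in>F. smul (\<Phi> i - (\<phi> i + \<Phi> i) / 2) (e i))"
    unfolding S_def m_def using K mK eF by (intro lincomb_diff)
  also have "\<dots> = d"
    unfolding d_def by (simp add: field_simps)
  finally have Sm: "S - m = d" .
  have "m - s = (\<Sum>i\<in>F. smul ((\<phi> i + \<Phi> i) / 2 - \<phi> i) (e i))"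
    unfolding s_def m_def using K mK eF by (intro lincomb_diff)
  also have "\<dots> = d"
    unfolding d_def by (simp add: field_simps)
  finally have ms: "m - s = d" .
  have "S - x = d - (x - m)" and "x - s = d + (x - m)"
    by (simp add: Sm[symmetric], simp add: ms[symmetric])
  then have angle: "Re (ip (S - x) (x - s)) = Re (ip d d) - Re (ip (x - m) (x - m))"
    using Re_ip_diff_add[OF dH yH] by (simp only:)
  have "ip d d = (\<Sum>i\<in>F. (\<Phi> i - \<phi> i) / 2 * cnj ((\<Phi> i - \<phi> i) / 2))"
    unfolding d_def using on eI F dK dK by (rule ip_lincomb_orthonormal)
  also have "\<dots> = (\<Sum>i\<in>F. complex_of_real ((cmod (\<Phi> i - \<phi> i))\<^sup>2 / 4))"
    by (intro sum.cong) (simp_all add: complex_norm_square[unfolded of_real_power] del: complex_cnj_diff)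
  also have "\<dots> = complex_of_real (?D / 4)"
    by (simp add: sum_divide_distrib)
  finally have radius: "Re (ip d d) = ?D / 4"
    by (simp only: Re_complex_of_real)
  have "1 / 2 * sqrt ?D = sqrt (?D / 4)"
    by (simp add: real_sqrt_divide)
  then have "ip_norm ip (x - m) \<le> 1 / 2 * sqrt ?D \<longleftrightarrow> Re (ip (x - m) (x - m)) \<le> ?D / 4"
    by (simp only: ip_norm_def real_sqrt_le_iff)
  then show ?thesis
    using angle radius unfolding S_def s_def m_def by linarith
qed

text \<open>
  Bessel's inequality bounds \<open>\<Sum>i\<in>F. \<bar>\<langle>x, e i\<rangle>\<bar>\<^sup>2\<close> by \<open>\<parallel>x\<parallel>\<^sup>2\<close>; here \<open>\<parallel>x\<parallel>\<^sup>2\<close> is bounded by a multiple of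
  that sum. Positivity of \<open>P\<close> keeps the ball away from the vectors orthogonal to every \<open>e i\<close> with
  \<open>i \<in> F\<close>, at which that sum vanishes.
\<close>

lemma reverse_bessel:
  assumes on: "orthonormal_family ip I e" and eI: "e ` I \<subseteq> H"
    and F: "finite F" "F \<subseteq> I" and K: "\<phi> ` F \<subseteq> K" "\<Phi> ` F \<subseteq> K" and x: "x \<in> H"
    and pos: "0 < (\<Sum>i\<in>F. Re (\<Phi> i * cnj (\<phi> i)))"
    and angle: "0 \<le> Re (ip ((\<Sum>i\<in>F. smul (\<Phi> i) (e i)) - x) (x - (\<Sum>i\<in>F. smul (\<phi> i) (e i))))"
  shows "(ip_norm ip x)\<^sup>2 \<le>
    1 / 4 * ((\<Sum>i\<in>F. (cmod (\<Phi> i) + cmod (\<phi> i))\<^sup>2) / (\<Sum>i\<in>F. Re (\<Phi> i * cnj (\<phi> i))))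
      * (\<Sum>i\<in>F. (cmod (ip x (e i)))\<^sup>2)"
proof -
  define S where "S = (\<Sum>i\<in>F. smul (\<Phi> i) (e i))"
  define s where "s = (\<Sum>i\<in>F. smul (\<phi> i) (e i))"
  define P where "P = (\<Sum>i\<in>F. Re (\<Phi> i * cnj (\<phi> i)))"
  let ?A = "\<Sum>i\<in>F. (cmod (\<Phi> i) + cmod (\<phi> i))\<^sup>2"
  let ?B = "\<Sum>i\<in>F. (cmod (ip x (e i)))\<^sup>2"
  let ?N = "Re (ip x x)"
  have eF: "e ` F \<subseteq> H"
    using eI F by auto
  have SH: "S \<in> H" and sH: "s \<in> H"
    unfolding S_def s_def using K eF by (auto intro: lincomb_closed)
  have N: "0 \<le> ?N"
    using x by (rule Re_ip_self_nonneg)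
  have P: "Re (ip S s) = P"
    unfolding S_def s_def P_def using ip_lincomb_orthonormal[OF on eI F K(2) K(1)] by simp
  have "ip (S - x) (x - s) = ip S x - ip S s - ip x x + ip x s"
    using SH sH x by (simp add: ip_diff_left ip_diff_right diff_closed)
  then have "?N + P \<le> Re (ip S x) + Re (ip x s)"
    using angle P unfolding S_def s_def by simp
  also have "\<dots> = Re (ip x S) + Re (ip x s)"
    using ip_commute[OF x SH] by simp
  also have "\<dots> = (\<Sum>i\<in>F. Re (cnj (\<Phi> i) * ip x (e i)) + Re (cnj (\<phi> i) * ip x (e i)))"
    unfolding S_def s_def using K eF x by (simp add: ip_lincomb_right sum.distrib)
  also have "\<dots> \<le> (\<Sum>i\<in>F. (cmod (\<Phi> i) + cmod (\<phi> i)) * cmod (ip x (e i)))"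
  proof (rule sum_mono)
    fix i
    have "Re (cnj (a i) * ip x (e i)) \<le> cmod (a i) * cmod (ip x (e i))" for a
      using complex_Re_le_cmod[of "cnj (a i) * ip x (e i)"] by (simp only: norm_mult complex_mod_cnj)
    from this[of \<Phi>] this[of \<phi>]
    show "Re (cnj (\<Phi> i) * ip x (e i)) + Re (cnj (\<phi> i) * ip x (e i))
        \<le> (cmod (\<Phi> i) + cmod (\<phi> i)) * cmod (ip x (e i))"
      by (simp only: distrib_right add_mono)
  qed
  finally have upper: "?N + P \<le> (\<Sum>i\<in>F. (cmod (\<Phi> i) + cmod (\<phi> i)) * cmod (ip x (e i)))" .
  have "4 * ?N * P = (?N + P)\<^sup>2 - (?N - P)\<^sup>2"
    by (simp add: power2_eq_square algebra_simps)
  then have "4 * ?N * P \<le> (?N + P)\<^sup>2"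
    by simp
  also have "\<dots> \<le> (\<Sum>i\<in>F. (cmod (\<Phi> i) + cmod (\<phi> i)) * cmod (ip x (e i)))\<^sup>2"
    using upper N pos unfolding P_def by (intro power_mono) auto
  also have "\<dots> \<le> ?A * ?B"
    by (rule Cauchy_Schwarz_ineq_sum)
  finally have "?N \<le> 1 / 4 * (?A / P) * ?B"
    using pos unfolding P_def[symmetric] by (simp add: field_simps)
  then show ?thesis
    using ip_norm_power2[OF x] unfolding P_def by simp
qed

end

section \<open>The scalar line\<close>

text \<open>
  Functions that vanish off \<open>0\<close> are determined by one value in \<open>K\<close>, so they form a copy of \<open>K\<close>, as
  a space over itself, in the ambient group \<open>nat \<Rightarrow> complex\<close>.
\<close>

definition scalar_line :: "complex set \<Rightarrow> (nat \<Rightarrow> complex) set" where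
  "scalar_line K = {f. f 0 \<in> K \<and> (\<forall>n>0. f n = 0)}"

definition unit_at_zero :: "nat \<Rightarrow> complex" where
  "unit_at_zero n = (if n = 0 then 1 else 0)"

lemma inner_product_space_scalar_line:
  assumes "K = \<real> \<or> K = UNIV"
  shows "inner_product_space K (scalar_line K) (\<lambda>a f n. a * f n) (\<lambda>f g. f 0 * cnj (g 0))"
proof unfold_locales
  fix f assume f: "f \<in> scalar_line K" "f \<noteq> 0"
  have "f 0 \<noteq> 0"
  proof
    assume "f 0 = 0"
    then have "f n = 0" for n
      using f(1) by (cases n) (auto simp: scalar_line_def)
    with f(2) show False
      by (auto simp: fun_eq_iff)
  qed
  then have "0 < (cmod (f 0))\<^sup>2"
    by simp
  then show "0 < Re (f 0 * cnj (f 0))"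
    by (simp only: complex_norm_square[symmetric] Re_complex_of_real)
qed (use assms in \<open>auto simp: scalar_line_def fun_eq_iff algebra_simps Reals_cnj_iff\<close>)

text \<open>
  With \<open>\<phi> = \<Phi> = 1\<close> the ball degenerates to the single point \<open>x = e\<close>, so both conditions hold with
  equality, and so does the bound with constant \<open>1/4\<close>.
\<close>

lemma orthonormal_setting_scalar_line:
  assumes "K = \<real> \<or> K = UNIV"
  shows "orthonormal_setting K (scalar_line K) (\<lambda>a f n. a * f n) (\<lambda>f g. f 0 * cnj (g 0))
    {0 :: nat} (\<lambda>_. unit_at_zero) {0} (\<lambda>_. 1) (\<lambda>_. 1) unit_at_zero"
  unfolding orthonormal_setting_def orthonormal_family_def
  using assms inner_product_space_scalar_line[OF assms]
  by (auto simp: scalar_line_def unit_at_zero_def ip_norm_def)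

section \<open>Equivalence, bound and sharpness\<close>

theorem theorem3:
  fixes K :: "complex set"
    and H :: "'v::ab_group_add set"
    and smul :: "complex \<Rightarrow> 'v \<Rightarrow> 'v"
    and ip :: "'v \<Rightarrow> 'v \<Rightarrow> complex"
    and I F :: "'i set"
    and e :: "'i \<Rightarrow> 'v"
    and \<phi> \<Phi> :: "'i \<Rightarrow> complex"
    and x :: 'v
  assumes "K = \<real> \<or> K = UNIV"
  shows
    "(orthonormal_setting K H smul ip I e F \<phi> \<Phi> x \<longrightarrow>
       (let cond_i = Re (ip ((\<Sum>i\<in>F. smul (\<Phi> i) (e i)) - x)
                            (x - (\<Sum>i\<in>F. smul (\<phi> i) (e i)))) \<ge> 0;
            cond_ii = ip_norm ip (x - (\<Sum>i\<in>F. smul ((\<phi> i + \<Phi> i) / 2) (e i)))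
                        \<le> 1 / 2 * sqrt (\<Sum>i\<in>F. (cmod (\<Phi> i - \<phi> i))\<^sup>2)
        in (cond_i \<longleftrightarrow> cond_ii) \<and>
           (cond_i \<or> cond_ii \<longrightarrow>
             (ip_norm ip x)\<^sup>2 \<le>
               1 / 4 * ((\<Sum>i\<in>F. (cmod (\<Phi> i) + cmod (\<phi> i))\<^sup>2) / (\<Sum>i\<in>F. Re (\<Phi> i * cnj (\<phi> i))))
                 * (\<Sum>i\<in>F. (cmod (ip x (e i)))\<^sup>2)))) \<and>
     \<not> (\<exists>c<1/4. \<forall>(H' :: (nat \<Rightarrow> complex) set) smul' ip' (I' :: nat set) e' F' \<phi>' \<Phi>' x'.
          orthonormal_setting K H' smul' ip' I' e' F' \<phi>' \<Phi>' x' \<longrightarrow>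
          (Re (ip' ((\<Sum>i\<in>F'. smul' (\<Phi>' i) (e' i)) - x')
                   (x' - (\<Sum>i\<in>F'. smul' (\<phi>' i) (e' i)))) \<ge> 0 \<or>
           ip_norm ip' (x' - (\<Sum>i\<in>F'. smul' ((\<phi>' i + \<Phi>' i) / 2) (e' i)))
             \<le> 1 / 2 * sqrt (\<Sum>i\<in>F'. (cmod (\<Phi>' i - \<phi>' i))\<^sup>2)) \<longrightarrow>
          (ip_norm ip' x')\<^sup>2 \<le>
            c * ((\<Sum>i\<in>F'. (cmod (\<Phi>' i) + cmod (\<phi>' i))\<^sup>2) / (\<Sum>i\<in>F'. Re (\<Phi>' i * cnj (\<phi>' i))))
              * (\<Sum>i\<in>F'. (cmod (ip' x' (e' i)))\<^sup>2))"
proof (intro conjI impI)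
  assume setting: "orthonormal_setting K H smul ip I e F \<phi> \<Phi> x"
  interpret inner_product_space K H smul ip
    using setting by (simp add: orthonormal_setting_def)
  have h: "orthonormal_family ip I e" "e ` I \<subseteq> H" "finite F" "F \<subseteq> I" "\<phi> ` F \<subseteq> K" "\<Phi> ` F \<subseteq> K" "x \<in> H"
    and pos: "0 < (\<Sum>i\<in>F. Re (\<Phi> i * cnj (\<phi> i)))"
    using setting by (simp_all add: orthonormal_setting_def)
  note equiv = angle_condition_iff_ball_condition[OF h]
  note bound = reverse_bessel[OF h pos]
  show "let cond_i = Re (ip ((\<Sum>i\<in>F. smul (\<Phi> i) (e i)) - x)
                            (x - (\<Sum>i\<in>F. smul (\<phi> i) (e i)))) \<ge> 0;
            cond_ii = ip_norm ip (x - (\<Sum>i\<in>F. smul ((\<phi> i + \<Phi> i) / 2) (e i)))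
                        \<le> 1 / 2 * sqrt (\<Sum>i\<in>F. (cmod (\<Phi> i - \<phi> i))\<^sup>2)
        in (cond_i \<longleftrightarrow> cond_ii) \<and>
           (cond_i \<or> cond_ii \<longrightarrow>
             (ip_norm ip x)\<^sup>2 \<le>
               1 / 4 * ((\<Sum>i\<in>F. (cmod (\<Phi> i) + cmod (\<phi> i))\<^sup>2) / (\<Sum>i\<in>F. Re (\<Phi> i * cnj (\<phi> i))))
                 * (\<Sum>i\<in>F. (cmod (ip x (e i)))\<^sup>2))"
    unfolding Let_def using equiv bound by blast
next
  let ?smul = "\<lambda>a f n. a * f n :: complex"
  let ?ip = "\<lambda>f g :: nat \<Rightarrow> complex. f 0 * cnj (g 0)"
  show "\<not> (\<exists>c<1/4. \<forall>(H' :: (nat \<Rightarrow> complex) set) smul' ip' (I' :: nat set) e' F' \<phi>' \<Phi>' x'.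
          orthonormal_setting K H' smul' ip' I' e' F' \<phi>' \<Phi>' x' \<longrightarrow>
          (Re (ip' ((\<Sum>i\<in>F'. smul' (\<Phi>' i) (e' i)) - x')
                   (x' - (\<Sum>i\<in>F'. smul' (\<phi>' i) (e' i)))) \<ge> 0 \<or>
           ip_norm ip' (x' - (\<Sum>i\<in>F'. smul' ((\<phi>' i + \<Phi>' i) / 2) (e' i)))
             \<le> 1 / 2 * sqrt (\<Sum>i\<in>F'. (cmod (\<Phi>' i - \<phi>' i))\<^sup>2)) \<longrightarrow>
          (ip_norm ip' x')\<^sup>2 \<le>
            c * ((\<Sum>i\<in>F'. (cmod (\<Phi>' i) + cmod (\<phi>' i))\<^sup>2) / (\<Sum>i\<in>F'. Re (\<Phi>' i * cnj (\<phi>' i))))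
              * (\<Sum>i\<in>F'. (cmod (ip' x' (e' i)))\<^sup>2))" (is "\<not> (\<exists>c<1/4. ?bound c)")
  proof
    assume "\<exists>c<1/4. ?bound c"
    then obtain c :: real where c: "c < 1 / 4" and bound: "?bound c"
      by blast
    have "1 \<le> c * 4"
      using bound[rule_format, OF orthonormal_setting_scalar_line[OF assms]]
      by (simp add: unit_at_zero_def ip_norm_def)
    with c show False
      by simp
  qed
qed

end
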